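(* Let $n\ge 1$, let $p \in \mathbb{C}[z_1,\ldots,z_n]$ be an atoral polynomial with no zeros in $\mathbb{D}^n$, and let $\phi = \tilde{p}/p$ be the corresponding rational inner function on $\mathbb{D}^n$. Suppose $1/p \in \mathcal{D}_\alpha(\mathbb{D}^n)$ for some real $\alpha < 0$. Then $\phi \in \mathcal{D}_{\alpha + 2/n}(\mathbb{D}^n)$.
   Context: $\mathbb{D}^n = \{z \in \mathbb{C}^n : |z_j| < 1,\ j = 1,\ldots,n\}$ is the unit polydisc. For a polynomial $p$ of multi-degree $(d_1,\ldots,d_n)$ (i.e. of degree $d_j$ in $z_j$), its reflection is the polynomial $\tilde{p}(z) = z_1^{d_1}\cdots z_n^{d_n}\, \overline{p(1/\overline{z_1},\ldots,1/\overline{z_n})}$. "Atoral" means here: $p$ is not constant in any of the variables $z_1,\ldots,z_n$, and $p$ and $\tilde p$ have no common factors. If $p$ has no zeros in $\mathbb{D}^n$ then $\tilde p / p$ is a rational inner function, i.e. bounded and holomorphic on $\mathbb{D}^n$ with modulus $1$ a.e. on $\mathbb{T}^n$. For a scalar $\beta \in \mathbb{R}$, $\mathcal{D}_\beta(\mathbb{D}^n) = \mathcal{D}_{\beta,\ldots,\beta}(\mathbb{D}^n)$ is the set of holomorphic $f(z) = \sum_{k \in \mathbb{N}^n} \hat f(k) z^k$ on $\mathbb{D}^n$ (with $0\in\mathbb{N}$) such that $\sum_{k \in \mathbb{N}^n} (1+k_1)^{\beta}\cdots(1+k_n)^{\beta} |\hat f(k)|^2 < \infty$. *)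

theory Defs
  imports "HOL-Analysis.Analysis" "HOL-Library.Poly_Mapping"
begin

text \<open>
  The index type \<open>'n\<close> is finite and plays the role of \<open>{1, ..., n}\<close>, so multi-indices in
  \<open>\<nat>\<^sup>n\<close> are \<^typ>\<open>'n \<Rightarrow>\<^sub>0 nat\<close>. The ring structure of \<^theory>\<open>HOL-Library.Poly_Mapping\<close> makes the
  following type the polynomial ring in the variables \<open>z\<^sub>j\<close>, \<open>j :: 'n\<close>, over the complex numbers.
\<close>

type_synonym 'n cpoly = "('n \<Rightarrow>\<^sub>0 nat) \<Rightarrow>\<^sub>0 complex"

definition monomial_at :: "('n::finite \<Rightarrow>\<^sub>0 nat) \<Rightarrow> complex ^ 'n \<Rightarrow> complex" where
  "monomial_at k z = (\<Prod>j\<in>UNIV. (z $ j) ^ Poly_Mapping.lookup k j)"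

definition poly_at :: "'n::finite cpoly \<Rightarrow> complex ^ 'n \<Rightarrow> complex" where
  "poly_at p z = (\<Sum>k\<in>Poly_Mapping.keys p. Poly_Mapping.lookup p k * monomial_at k z)"

definition polydisc :: "(complex ^ 'n::finite) set" where
  "polydisc = {z. \<forall>j. norm (z $ j) < 1}"

definition degree_in :: "'n \<Rightarrow> 'n cpoly \<Rightarrow> nat" where
  "degree_in j p = Max (insert 0 ((\<lambda>k. Poly_Mapping.lookup k j) ` Poly_Mapping.keys p))"

definition multidegree :: "'n::finite cpoly \<Rightarrow> ('n \<Rightarrow>\<^sub>0 nat)" where
  "multidegree p = (\<Sum>j\<in>UNIV. Poly_Mapping.single j (degree_in j p))"

text \<open>
  The reflection as an element of the polynomial ring: each term \<open>a z\<^sup>k\<close> of \<open>p\<close> becomes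
  \<open>cnj a z\<^sup>d\<^sup>-\<^sup>k\<close>, where \<open>d\<close> is the multidegree. Lemma \<open>poly_at_reflection\<close> below shows
  that it is the polynomial with the usual values \<open>z\<^sup>d cnj (p (1 / cnj z))\<close>.
\<close>

definition reflection :: "'n::finite cpoly \<Rightarrow> 'n cpoly" where
  "reflection p =
     (\<Sum>k\<in>Poly_Mapping.keys p. Poly_Mapping.single (multidegree p - k) (cnj (Poly_Mapping.lookup p k)))"

text \<open>
  Units of the polynomial ring are the nonzero constants, so the second conjunct says that
  \<open>p\<close> and its reflection have no nonconstant common factor.
\<close>

definition atoral :: "'n::finite cpoly \<Rightarrow> bool" where
  "atoral p \<longleftrightarrow>
     (\<forall>j. degree_in j p \<noteq> 0) \<and> (\<forall>q. q dvd p \<longrightarrow> q dvd reflection p \<longrightarrow> q dvd 1)"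

definition rational_inner :: "'n::finite cpoly \<Rightarrow> complex ^ 'n \<Rightarrow> complex" where
  "rational_inner p z = poly_at (reflection p) z / poly_at p z"

text \<open>Holomorphy in several variables: real differentiability with complex linear derivative.\<close>

definition holomorphic_several_on ::
  "(complex ^ 'n::finite \<Rightarrow> complex) \<Rightarrow> (complex ^ 'n) set \<Rightarrow> bool" where
  "holomorphic_several_on f S \<longleftrightarrow>
     (\<forall>z\<in>S. \<exists>A :: complex ^ 'n. (f has_derivative (\<lambda>h. \<Sum>j\<in>UNIV. A $ j * h $ j)) (at z within S))"

text \<open>
  The coefficient family \<open>c\<close> is unique, being the family of Taylor coefficients of \<open>f\<close> at \<open>0\<close>;
  membership depends only on the values of \<open>f\<close> on the polydisc.
\<close>

definition dirichlet_space :: "real \<Rightarrow> (complex ^ 'n::finite \<Rightarrow> complex) set" where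
  "dirichlet_space \<beta> = {f. holomorphic_several_on f polydisc \<and>
     (\<exists>c :: ('n \<Rightarrow>\<^sub>0 nat) \<Rightarrow> complex.
        (\<forall>z\<in>polydisc. ((\<lambda>k. c k * monomial_at k z) has_sum f z) UNIV) \<and>
        (\<lambda>k. (\<Prod>j\<in>UNIV. (1 + real (Poly_Mapping.lookup k j)) powr \<beta>) * (norm (c k))\<^sup>2) summable_on UNIV)}"

lemma poly_at_superset:
  assumes "finite A" "Poly_Mapping.keys p \<subseteq> A"
  shows "poly_at p z = (\<Sum>k\<in>A. Poly_Mapping.lookup p k * monomial_at k z)"
  unfolding poly_at_def using assms
  by (intro sum.mono_neutral_left) (auto simp: in_keys_iff)

lemma poly_at_0 [simp]: "poly_at 0 z = 0"
  by (simp add: poly_at_def)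

lemma poly_at_single [simp]: "poly_at (Poly_Mapping.single k a) z = a * monomial_at k z"
  by (subst poly_at_superset[of "{k}"]) auto

lemma poly_at_add: "poly_at (p + q) z = poly_at p z + poly_at q z"
proof -
  let ?A = "Poly_Mapping.keys p \<union> Poly_Mapping.keys q"
  have "Poly_Mapping.keys (p + q) \<subseteq> ?A"
    by (rule keys_add)
  then show ?thesis
    by (simp add: poly_at_superset[of ?A] lookup_add distrib_right sum.distrib)
qed

lemma poly_at_sum: "poly_at (\<Sum>i\<in>I. f i) z = (\<Sum>i\<in>I. poly_at (f i) z)"
  by (induction I rule: infinite_finite_induct) (simp_all add: poly_at_add)

lemma lookup_multidegree [simp]: "Poly_Mapping.lookup (multidegree p) j = degree_in j p"
  by (simp add: multidegree_def lookup_sum lookup_single when_def)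

lemma lookup_le_degree_in:
  assumes "k \<in> Poly_Mapping.keys p"
  shows "Poly_Mapping.lookup k j \<le> degree_in j p"
  using assms unfolding degree_in_def by (intro Max_ge) auto

lemma poly_at_reflection:
  assumes "\<And>j. z $ j \<noteq> 0"
  shows "poly_at (reflection p) z =
    (\<Prod>j\<in>UNIV. (z $ j) ^ degree_in j p) * cnj (poly_at p (\<chi> j. 1 / cnj (z $ j)))"
proof -
  have "monomial_at (multidegree p - k) z =
      (\<Prod>j\<in>UNIV. (z $ j) ^ degree_in j p) * cnj (monomial_at k (\<chi> j. 1 / cnj (z $ j)))"
    if "k \<in> Poly_Mapping.keys p" for k
    unfolding monomial_at_def
    using assms lookup_le_degree_in[OF that]
    by (simp add: lookup_minus power_diff power_divide prod_dividef)
  then show ?thesis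
    unfolding reflection_def poly_at_sum poly_at_def[of p]
    by (simp add: sum_distrib_left mult_ac)
qed

end

theory Submission
  imports Defs "HOL-Complex_Analysis.Conformal_Mappings"
begin

text \<open>
  Write \<open>\<theta>\<^sub>j = z\<^sub>j \<partial>/\<partial>z\<^sub>j\<close>, \<open>q\<close> for the reflection of \<open>p\<close> and \<open>\<phi> = q/p\<close>. Differentiating
  \<open>p \<phi> = q\<close> gives \<open>\<theta>\<^sub>j \<phi> = (1/p) (\<theta>\<^sub>j q - \<phi> \<theta>\<^sub>j p)\<close>, where the second factor is bounded on the
  polydisc because \<open>\<bar>\<phi>\<bar> \<le> 1\<close>. For \<open>\<alpha> < 0\<close> bounded holomorphic functions multiply the space of
  parameter \<open>\<alpha>\<close> into itself: Parseval's identity on each torus gives the estimate with weights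
  \<open>r\<^sup>2\<^sup>k\<close>, and \<open>(1 + m) powr \<alpha>\<close> is a positive mixture of the powers \<open>t\<^sup>m\<close>, \<open>0 < t < 1\<close>, by the Gamma
  integral. So \<open>\<phi>\<close> and all \<open>\<theta>\<^sub>j \<phi>\<close> lie in the space of parameter \<open>\<alpha>\<close>, and the product of the
  \<open>(1 + k\<^sub>j) powr (2/n)\<close> is at most the sum of the \<open>(1 + k\<^sub>j)\<^sup>2\<close>.
\<close>

subsection \<open>Weights\<close>

text \<open>Substituting \<open>a * t\<close> for \<open>t\<close> in Euler's integral for
  \<open>Gamma x\<close> writes \<open>a powr (- x)\<close> as a positive mixture of the
  exponentials \<open>exp (- a * t)\<close>. It is used with \<open>a = 1 + m\<close> and
  \<open>x = - \<alpha>\<close>.\<close>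

lemma Gamma_scaled_has_bochner_integral:
  fixes a x :: real
  assumes "x > 0" "a > 0"
  shows "has_bochner_integral lborel
    (\<lambda>t. indicator {0..} t * t powr (x - 1) / exp (a * t)) (Gamma x * a powr (- x))"
proof -
  have "has_bochner_integral lborel (\<lambda>t. indicator {0..} t * t powr (x - 1) / exp t) (Gamma x)"
  proof (rule has_bochner_integral_nn_integral)
    show "(\<integral>\<^sup>+ t. ennreal (indicator {0..} t * t powr (x - 1) / exp t) \<partial>lborel) = ennreal (Gamma x)"
      using Gamma_conv_nn_integral_real[OF assms(1)] by simp
  qed (use assms Gamma_real_pos[OF assms(1)] in auto)
  then have "has_bochner_integral lborel
      (\<lambda>t. indicator {0..} (0 + a * t) * (0 + a * t) powr (x - 1) / exp (0 + a * t))
      (Gamma x /\<^sub>R \<bar>a\<bar>)"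
    using assms(2) by (subst (asm) lborel_has_bochner_integral_real_affine_iff[of a _ _ 0]) auto
  then have *: "has_bochner_integral lborel
      (\<lambda>t. a powr (1 - x) * (indicator {0..} (a * t) * (a * t) powr (x - 1) / exp (a * t)))
      (a powr (1 - x) * (Gamma x /\<^sub>R \<bar>a\<bar>))"
    by (intro has_bochner_integral_mult_right) simp
  have "a powr (1 - x) * (indicator {0..} (a * t) * (a * t) powr (x - 1) / exp (a * t))
      = indicator {0..} t * t powr (x - 1) / exp (a * t)" for t
  proof -
    have "a powr (1 - x) * a powr (x - 1) = 1"
      using assms(2) by (simp flip: powr_add)
    moreover have "indicator {0..} (a * t) = (indicator {0..} t :: real)"
      using assms(2) by (auto simp: indicator_def zero_le_mult_iff)
    ultimately show ?thesis
      using assms(2) by (auto simp: powr_mult indicator_def)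
  qed
  moreover have "a powr (1 - x) * (Gamma x /\<^sub>R \<bar>a\<bar>) = Gamma x * a powr (- x)"
    using assms(2) by (simp add: powr_diff powr_minus field_simps)
  ultimately show ?thesis
    using * by (simp only:)
qed

text \<open>Since \<open>exp (- (1 + m) * t) = s * s ^ m\<close> with \<open>s = exp (- t)\<close>,
  the Gamma integral exhibits the weighted sum, up to the factor
  \<open>Gamma (- \<alpha>) > 0\<close>, as the integral of the sums with powers
  \<open>s ^ m\<close> against a positive density. The coefficients \<open>b\<close> may have either
  sign: what is transported is positivity of the whole sum.\<close>

lemma sum_powr_nonneg_of_sum_power_nonneg:
  fixes b :: "'a \<Rightarrow> real" and m :: "'a \<Rightarrow> nat" and \<alpha> :: real
  assumes "\<alpha> < 0"
    and nonneg: "\<And>t. 0 < t \<Longrightarrow> t < 1 \<Longrightarrow> (\<Sum>k\<in>A. b k * t ^ m k) \<ge> 0"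
  shows "(\<Sum>k\<in>A. b k * (1 + real (m k)) powr \<alpha>) \<ge> 0"
proof -
  define f where "f = (\<lambda>k t. indicator {0..} t * t powr (- \<alpha> - 1) / exp ((1 + real (m k)) * t))"
  have "has_bochner_integral lborel (f k) (Gamma (- \<alpha>) * (1 + real (m k)) powr \<alpha>)" for k
    using Gamma_scaled_has_bochner_integral[of "- \<alpha>" "1 + real (m k)"] assms(1)
    by (simp add: f_def)
  then have int: "has_bochner_integral lborel (\<lambda>t. \<Sum>k\<in>A. b k * f k t)
      (\<Sum>k\<in>A. b k * (Gamma (- \<alpha>) * (1 + real (m k)) powr \<alpha>))"
    by (intro has_bochner_integral_sum has_bochner_integral_mult_right)
  have "(\<Sum>k\<in>A. b k * f k t) \<ge> 0" for t :: real
  proof (cases "t > 0")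
    case True
    have "exp (- ((1 + real (m k)) * t)) = exp (- t) * exp (- t) ^ m k" for k
      by (simp add: exp_of_nat_mult[symmetric] algebra_simps flip: exp_add)
    then have "(\<Sum>k\<in>A. b k * f k t)
        = t powr (- \<alpha> - 1) * exp (- t) * (\<Sum>k\<in>A. b k * exp (- t) ^ m k)"
      using True by (simp add: f_def sum_distrib_left divide_inverse mult_ac flip: exp_minus)
    then show ?thesis
      using nonneg[of "exp (- t)"] True by simp
  qed (auto simp: f_def indicator_def)
  then have "(\<Sum>k\<in>A. b k * (Gamma (- \<alpha>) * (1 + real (m k)) powr \<alpha>)) \<ge> 0"
    unfolding has_bochner_integral_integral_eq[OF int, symmetric]
    by (intro Bochner_Integration.integral_nonneg)
  also have "(\<Sum>k\<in>A. b k * (Gamma (- \<alpha>) * (1 + real (m k)) powr \<alpha>))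
      = Gamma (- \<alpha>) * (\<Sum>k\<in>A. b k * (1 + real (m k)) powr \<alpha>)"
    by (simp add: sum_distrib_left mult_ac)
  finally have "Gamma (- \<alpha>) * (\<Sum>k\<in>A. b k * (1 + real (m k)) powr \<alpha>) \<ge> 0" .
  moreover have "Gamma (- \<alpha>) > 0"
    using assms(1) by (intro Gamma_real_pos) simp
  ultimately show ?thesis
    by (simp only: zero_le_mult_iff) auto
qed

text \<open>The one-variable version is applied to one coordinate at a time, with the factors of all
  other coordinates absorbed into the coefficients.\<close>

lemma sum_prod_powr_nonneg_of_sum_prod_power_nonneg:
  fixes a :: "'a \<Rightarrow> real" and m :: "'a \<Rightarrow> 'n::finite \<Rightarrow> nat" and \<alpha> :: real
  assumes "\<alpha> < 0"
    and nonneg: "\<And>t. (\<And>j. 0 < t j \<and> t j < 1) \<Longrightarrow> (\<Sum>k\<in>A. a k * (\<Prod>j\<in>UNIV. t j ^ m k j)) \<ge> 0"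
  shows "(\<Sum>k\<in>A. a k * (\<Prod>j\<in>UNIV. (1 + real (m k j)) powr \<alpha>)) \<ge> 0"
proof -
  \<comment> \<open>Mixed weights for the induction: coordinates in \<open>S\<close> already carry
    the final weight, the others still carry a power of \<open>t\<close>.\<close>
  define w where "w = (\<lambda>S (t :: 'n \<Rightarrow> real) k j.
    if j \<in> S then (1 + real (m k j)) powr \<alpha> else t j ^ m k j)"
  have "\<forall>t. (\<forall>j. 0 < t j \<and> t j < 1) \<longrightarrow> (\<Sum>k\<in>A. a k * (\<Prod>j\<in>UNIV. w S t k j)) \<ge> 0"
    if "finite S" for S :: "'n set"
    using that
  proof (induction S)
    case empty
    then show ?case
      by (auto simp: w_def intro!: nonneg)
  next
    case (insert i S)
    show ?case
    proof (intro allI impI)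
      fix t :: "'n \<Rightarrow> real"
      assume t: "\<forall>j. 0 < t j \<and> t j < 1"
      define b where "b = (\<lambda>k. a k * (\<Prod>j\<in>UNIV - {i}. w S t k j))"
      have "(\<Sum>k\<in>A. b k * s ^ m k i) \<ge> 0" if s: "0 < s" "s < 1" for s
      proof -
        have "b k * s ^ m k i = a k * (\<Prod>j\<in>UNIV. w S (t(i := s)) k j)" for k
        proof -
          have "(\<Prod>j\<in>UNIV. w S (t(i := s)) k j)
              = w S (t(i := s)) k i * (\<Prod>j\<in>UNIV - {i}. w S (t(i := s)) k j)"
            by (intro prod.remove) auto
          also have "(\<Prod>j\<in>UNIV - {i}. w S (t(i := s)) k j) = (\<Prod>j\<in>UNIV - {i}. w S t k j)"
            by (intro prod.cong) (auto simp: w_def)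
          also have "w S (t(i := s)) k i = s ^ m k i"
            using insert.hyps by (simp add: w_def)
          finally show ?thesis
            by (simp add: b_def mult_ac del: fun_upd_apply)
        qed
        then show ?thesis
          using insert.IH[rule_format, of "t(i := s)"] s t by simp
      qed
      then have "(\<Sum>k\<in>A. b k * (1 + real (m k i)) powr \<alpha>) \<ge> 0"
        by (rule sum_powr_nonneg_of_sum_power_nonneg[OF assms(1)])
      moreover have "b k * (1 + real (m k i)) powr \<alpha> = a k * (\<Prod>j\<in>UNIV. w (insert i S) t k j)" for k
      proof -
        have "(\<Prod>j\<in>UNIV. w (insert i S) t k j)
            = w (insert i S) t k i * (\<Prod>j\<in>UNIV - {i}. w (insert i S) t k j)"
          by (intro prod.remove) auto
        also have "(\<Prod>j\<in>UNIV - {i}. w (insert i S) t k j) = (\<Prod>j\<in>UNIV - {i}. w S t k j)"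
          by (intro prod.cong) (auto simp: w_def)
        finally show ?thesis
          by (simp add: b_def w_def)
      qed
      ultimately show "(\<Sum>k\<in>A. a k * (\<Prod>j\<in>UNIV. w (insert i S) t k j)) \<ge> 0"
        by simp
    qed
  qed
  \<comment> \<open>For \<open>S = UNIV\<close> the weights no longer involve \<open>t\<close>, so
    any admissible value such as 1/2 will do.\<close>
  from this[of UNIV, rule_format, of "\<lambda>_. 1 / 2"] show ?thesis
    by (simp add: w_def)
qed

text \<open>Each \<open>x j powr (2/n)\<close> is at most \<open>S powr (1/n)\<close>, where
  \<open>S\<close> is the sum of squares, and \<open>n\<close> such factors multiply to
  \<open>S\<close>. This is the origin of the gain \<open>2/n\<close>.\<close>

lemma prod_powr_le_sum_squares:
  fixes x :: "'n::finite \<Rightarrow> real"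
  assumes "\<And>j. x j \<ge> 1"
  shows "(\<Prod>j\<in>UNIV. x j powr (2 / real CARD('n))) \<le> (\<Sum>j\<in>UNIV. (x j)\<^sup>2)"
proof -
  define S where "S = (\<Sum>j\<in>UNIV. (x j)\<^sup>2)"
  have le: "(x j)\<^sup>2 \<le> S" for j
    unfolding S_def by (rule member_le_sum) auto
  have pos: "x j > 0" for j
    using assms[of j] by simp
  \<comment> \<open>Types are nonempty, so \<open>undefined\<close> serves as some index
    \<open>j\<close>.\<close>
  have "S > 0"
    using le[of undefined] pos[of undefined] by (meson less_le_trans zero_less_power)
  have "(\<Prod>j\<in>UNIV. x j powr (2 / real CARD('n))) \<le> (\<Prod>j\<in>(UNIV::'n set). S powr (1 / real CARD('n)))"
  proof (intro prod_mono conjI)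
    fix j
    have "x j powr (2 / real CARD('n)) = ((x j)\<^sup>2) powr (1 / real CARD('n))"
      using pos[of j] by (simp add: powr_powr flip: powr_numeral)
    also have "\<dots> \<le> S powr (1 / real CARD('n))"
      using le by (intro powr_mono2) auto
    finally show "x j powr (2 / real CARD('n)) \<le> S powr (1 / real CARD('n))" .
  qed auto
  also have "\<dots> = S"
    using \<open>S > 0\<close> by (simp add: powr_powr flip: powr_realpow)
  finally show ?thesis
    by (simp add: S_def)
qed

subsection \<open>Power series on the polydisc\<close>

abbreviation lkp :: "('n \<Rightarrow>\<^sub>0 'b::zero) \<Rightarrow> 'n \<Rightarrow> 'b" where "lkp \<equiv> Poly_Mapping.lookup"

text \<open>The strict bound keeps the exponents in each coordinate distinct modulo
  \<open>N\<close>, so the \<open>N\<close>-th roots of unity can tell apart all monomials of the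
  box.\<close>

definition multi_box :: "nat \<Rightarrow> ('n::finite \<Rightarrow>\<^sub>0 nat) set" where
  "multi_box N = {k. \<forall>j. lkp k j < N}"

lemma finite_multi_box [simp]: "finite (multi_box N :: ('n::finite \<Rightarrow>\<^sub>0 nat) set)"
proof (rule finite_imageD)
  have "lkp ` (multi_box N :: ('n \<Rightarrow>\<^sub>0 nat) set) \<subseteq> UNIV \<rightarrow>\<^sub>E {..<N}"
    by (auto simp: multi_box_def)
  then show "finite (lkp ` (multi_box N :: ('n \<Rightarrow>\<^sub>0 nat) set))"
    by (rule finite_subset) (simp add: finite_PiE)
qed (simp add: inj_on_def poly_mapping_eqI)

lemma mono_multi_box: "N \<le> N' \<Longrightarrow> multi_box N \<subseteq> multi_box N'"
  by (auto simp: multi_box_def intro: less_le_trans)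

lemma finite_subset_multi_box:
  assumes "finite (A :: ('n::finite \<Rightarrow>\<^sub>0 nat) set)"
  obtains N where "A \<subseteq> multi_box N"
proof
  let ?B = "(\<lambda>(k, j). lkp k j) ` (A \<times> UNIV)"
  have "finite ?B"
    using assms by simp
  then show "A \<subseteq> multi_box (Suc (Max ?B))"
    by (auto simp: multi_box_def less_Suc_eq_le intro!: Max_ge)
qed

text \<open>Unconditional sums are limits along the net of finite index sets; the boxes are cofinal
  in it, which turns such sums into limits of sequences.\<close>

lemma filterlim_multi_box:
  "filterlim (multi_box :: nat \<Rightarrow> ('n::finite \<Rightarrow>\<^sub>0 nat) set) (finite_subsets_at_top UNIV) sequentially"
  unfolding filterlim_iff eventually_finite_subsets_at_top
proof safe
  fix P and X :: "('n \<Rightarrow>\<^sub>0 nat) set"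
  assume X: "finite X" and P: "\<forall>Y. finite Y \<and> X \<subseteq> Y \<and> Y \<subseteq> UNIV \<longrightarrow> P Y"
  obtain N where "X \<subseteq> multi_box N"
    using finite_subset_multi_box[OF X] .
  then have "P (multi_box m)" if "m \<ge> N" for m
    using P mono_multi_box[OF that] finite_multi_box[of m] by (metis order_trans subset_UNIV)
  then show "\<forall>\<^sub>F m in sequentially. P (multi_box m)"
    by (auto simp: eventually_sequentially)
qed

section \<open>Power series expansions and their Cauchy products\<close>

lemma monomial_at_add: "monomial_at (k + l) z = monomial_at k z * monomial_at l z"
  by (simp add: monomial_at_def lookup_add power_add prod.distrib)

text \<open>Pairing a coefficient family with a function lets identities be proved for values and
  carried back to coefficients, and conversely. Values of \<open>f\<close> off the polydisc are left
  free.\<close>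

definition expands ::
    "(('n::finite \<Rightarrow>\<^sub>0 nat) \<Rightarrow> complex) \<Rightarrow> (complex ^ 'n \<Rightarrow> complex) \<Rightarrow> bool" where
  "expands c f \<longleftrightarrow> (\<forall>z\<in>polydisc. ((\<lambda>k. c k * monomial_at k z) has_sum f z) UNIV)"

definition cauchy_coeff ::
    "(('n::finite \<Rightarrow>\<^sub>0 nat) \<Rightarrow> complex) \<Rightarrow> (('n \<Rightarrow>\<^sub>0 nat) \<Rightarrow> complex) \<Rightarrow> ('n \<Rightarrow>\<^sub>0 nat) \<Rightarrow> complex" where
  "cauchy_coeff c d k = (\<Sum>(a, b)\<in>{(a, b). a + b = k}. c a * d b)"

lemma finite_add_fibre [simp]: "finite {(a, b). a + b = (k :: 'n::finite \<Rightarrow>\<^sub>0 nat)}"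
proof -
  obtain N where N: "{k} \<subseteq> multi_box N"
    using finite_subset_multi_box[of "{k}"] by auto
  have "{(a, b). a + b = k} \<subseteq> multi_box N \<times> multi_box N"
    using N by (auto simp: multi_box_def lookup_add) (metis add_lessD1 add.commute)+
  then show ?thesis
    by (rule finite_subset) simp
qed

lemma expands_unique_value:
  "expands c f \<Longrightarrow> expands c g \<Longrightarrow> z \<in> polydisc \<Longrightarrow> f z = g z"
  unfolding expands_def by (blast intro: has_sum_unique)

lemma expands_cong:
  "expands c f \<Longrightarrow> (\<And>z. z \<in> polydisc \<Longrightarrow> f z = g z) \<Longrightarrow> expands c g"
  unfolding expands_def by simp

lemma expands_diff:
  "expands c f \<Longrightarrow> expands d g \<Longrightarrow> expands (\<lambda>k. c k - d k) (\<lambda>z. f z - g z)"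
  unfolding expands_def
proof
  fix z :: "complex ^ 'a"
  assume "\<forall>z\<in>polydisc. ((\<lambda>k. c k * monomial_at k z) has_sum f z) UNIV"
    "\<forall>z\<in>polydisc. ((\<lambda>k. d k * monomial_at k z) has_sum g z) UNIV" "z \<in> polydisc"
  then have "((\<lambda>k. c k * monomial_at k z + - (d k * monomial_at k z)) has_sum f z + - g z) UNIV"
    by (intro has_sum_add has_sum_uminusI) auto
  then show "((\<lambda>k. (c k - d k) * monomial_at k z) has_sum f z - g z) UNIV"
    by (simp add: left_diff_distrib)
qed

lemma expands_finite_support:
  assumes "finite A" "\<And>k. k \<notin> A \<Longrightarrow> c k = 0"
  shows "expands c (\<lambda>z. \<Sum>k\<in>A. c k * monomial_at k z)"
  unfolding expands_def
proof
  fix z :: "complex ^ 'a"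
  show "((\<lambda>k. c k * monomial_at k z) has_sum (\<Sum>k\<in>A. c k * monomial_at k z)) UNIV"
    by (rule has_sum_finite_neutralI[of A]) (use assms in auto)
qed

lemma expands_poly_at: "expands (lkp p) (poly_at p)"
  unfolding poly_at_def[abs_def] by (rule expands_finite_support) (auto simp: in_keys_iff)

text \<open>An unconditionally summable complex family is absolutely summable, so the double family
  \<open>x a * y b\<close> is summable over all pairs and can be regrouped along the finite fibres
  \<open>a + b = k\<close>.\<close>

lemma expands_mult:
  assumes "expands c f" "expands d g"
  shows "expands (cauchy_coeff c d) (\<lambda>z. f z * g z)"
  unfolding expands_def
proof
  fix z :: "complex ^ 'a"
  assume z: "z \<in> polydisc"
  define x where "x = (\<lambda>k. c k * monomial_at k z)"
  define y where "y = (\<lambda>k. d k * monomial_at k z)"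
  have x: "(x has_sum f z) UNIV" and y: "(y has_sum g z) UNIV"
    using assms z by (simp_all add: expands_def x_def y_def)
  have absx: "(\<lambda>k. norm (x k)) summable_on UNIV" and absy: "(\<lambda>k. norm (y k)) summable_on UNIV"
    using x y summable_on_iff_abs_summable_on_complex by (auto simp: summable_on_def)
  have "(\<lambda>p. norm (case p of (a, b) \<Rightarrow> x a * y b)) summable_on UNIV \<times> UNIV"
    using summable_on_cmult_right[OF absy] summable_on_cmult_left[OF absx]
    by (intro summable_on_SigmaI[where g = "\<lambda>a. norm (x a) * infsum (\<lambda>b. norm (y b)) UNIV"])
      (auto simp: norm_mult intro: has_sum_cmult_right[OF has_sum_infsum[OF absy]])
  then have "(\<lambda>(a, b). x a * y b) summable_on UNIV \<times> UNIV"
    by (rule abs_summable_summable)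
  then have "((\<lambda>(a, b). x a * y b) has_sum f z * g z) (UNIV \<times> UNIV)"
    by (intro has_sum_SigmaI[where g = "\<lambda>a. x a * g z"])
      (auto intro: has_sum_cmult_right[OF y] has_sum_cmult_left[OF x])
  moreover have "bij_betw (\<lambda>(k, ab). ab) (SIGMA k:UNIV. {(a, b). a + b = (k :: 'a \<Rightarrow>\<^sub>0 nat)}) (UNIV \<times> UNIV)"
    by (rule bij_betw_byWitness[where f' = "\<lambda>(a, b). (a + b, a, b)"]) auto
  ultimately have "((\<lambda>(k, a, b). x a * y b) has_sum f z * g z) (SIGMA k:UNIV. {(a, b). a + b = k})"
    by (subst (asm) has_sum_reindex_bij_betw[symmetric, of "\<lambda>(k, ab). ab"]) (simp_all add: case_prod_unfold)
  then have "((\<lambda>k. \<Sum>(a, b)\<in>{(a, b). a + b = k}. x a * y b) has_sum f z * g z) UNIV"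
    by (rule has_sum_SigmaD) (auto intro!: has_sum_finiteI)
  also have "(\<lambda>k. \<Sum>(a, b)\<in>{(a, b). a + b = k}. x a * y b) = (\<lambda>k. cauchy_coeff c d k * monomial_at k z)"
    unfolding cauchy_coeff_def x_def y_def
    unfolding sum_distrib_right
    by (intro ext sum.cong) (auto simp: monomial_at_add)
  finally show "((\<lambda>k. cauchy_coeff c d k * monomial_at k z) has_sum f z * g z) UNIV" .
qed

subsection \<open>Averages over roots of unity\<close>

text \<open>
  Means over the \<open>N\<close>-th roots of unity in each variable replace integrals over the torus: being
  finite sums, they commute with power series, and the aliasing error vanishes as \<open>N\<close> grows.
\<close>

definition character :: "nat \<Rightarrow> ('n::finite \<Rightarrow>\<^sub>0 nat) \<Rightarrow> ('n \<Rightarrow> nat) \<Rightarrow> complex" where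
  "character N k \<theta> = (\<Prod>j\<in>UNIV. cis (2 * pi * real (\<theta> j) / real N) ^ lkp k j)"

definition sample_point :: "('n::finite \<Rightarrow> real) \<Rightarrow> nat \<Rightarrow> ('n \<Rightarrow> nat) \<Rightarrow> complex ^ 'n" where
  "sample_point r N \<theta> = (\<chi> j. of_real (r j) * cis (2 * pi * real (\<theta> j) / real N))"

definition sample_mean :: "nat \<Rightarrow> (('n::finite \<Rightarrow> nat) \<Rightarrow> 'b) \<Rightarrow> 'b::real_vector" where
  "sample_mean N u = (\<Sum>\<theta>\<in>UNIV \<rightarrow>\<^sub>E {..<N}. u \<theta>) /\<^sub>R real (card ((UNIV :: 'n set) \<rightarrow>\<^sub>E {..<N}))"

lemma norm_character [simp]: "norm (character N k \<theta>) = 1"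
  unfolding character_def prod_norm[symmetric] by (simp add: norm_power)

lemma monomial_at_sample_point:
  "monomial_at k (sample_point r N \<theta>) = of_real (\<Prod>j\<in>UNIV. r j ^ lkp k j) * character N k \<theta>"
  by (simp add: monomial_at_def sample_point_def character_def power_mult_distrib prod.distrib)

lemma sample_mean_mono:
  fixes u v :: "('n::finite \<Rightarrow> nat) \<Rightarrow> real"
  assumes "\<And>\<theta>. u \<theta> \<le> v \<theta>"
  shows "sample_mean N u \<le> sample_mean N v"
  unfolding sample_mean_def using assms by (intro scaleR_left_mono sum_mono) auto

lemma sample_mean_sum:
  "sample_mean N (\<lambda>\<theta>. \<Sum>i\<in>I. u i \<theta>) = (\<Sum>i\<in>I. sample_mean N (u i))"
  unfolding sample_mean_def by (subst sum.swap) (simp add: scaleR_sum_right)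

lemma sample_mean_mult_left:
  fixes c :: "'b::real_algebra"
  shows "sample_mean N (\<lambda>\<theta>. c * u \<theta>) = c * sample_mean N u"
  unfolding sample_mean_def by (simp add: sum_distrib_left)

lemma sample_mean_add: "sample_mean N (\<lambda>\<theta>. u \<theta> + v \<theta>) = sample_mean N u + sample_mean N v"
  unfolding sample_mean_def by (simp add: sum.distrib scaleR_add_right)

lemma norm_sample_mean_le:
  fixes u :: "('n::finite \<Rightarrow> nat) \<Rightarrow> 'b::real_normed_vector"
  assumes "\<And>\<theta>. norm (u \<theta>) \<le> M" "M \<ge> 0"
  shows "norm (sample_mean N u) \<le> M"
proof -
  let ?T = "(UNIV :: 'n set) \<rightarrow>\<^sub>E {..<N}"
  have "norm (\<Sum>\<theta>\<in>?T. u \<theta>) \<le> real (card ?T) * M"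
    using assms by (intro sum_norm_bound)
  then show ?thesis
    using assms(2) by (cases "card ?T = 0") (simp_all add: sample_mean_def divide_simps mult.commute)
qed

text \<open>This is a geometric sum with ratio \<open>x = cis (2 * pi * (a - b) / N)\<close>. As
  \<open>x ^ N = 1\<close>, it vanishes unless \<open>x = 1\<close>; the latter makes
  \<open>N\<close> divide \<open>a - b\<close>, which forces \<open>a = b\<close> because the
  difference is smaller than \<open>N\<close> in absolute value.\<close>

lemma sum_roots_of_unity_powers:
  fixes a b N :: nat
  assumes "a < N" "b < N"
  shows "(\<Sum>t<N. cis (2 * pi * real t / real N) ^ a * cnj (cis (2 * pi * real t / real N) ^ b))
    = (if a = b then of_nat N else 0)"
proof -
  define x where "x = cis (2 * pi * (real a - real b) / real N)"
  have N: "N > 0"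
    using assms by simp
  have summand: "cis (2 * pi * real t / real N) ^ a * cnj (cis (2 * pi * real t / real N) ^ b) = x ^ t" for t
    by (simp add: x_def Complex.DeMoivre cis_cnj cis_mult diff_divide_distrib algebra_simps)
  have "x ^ N = cis (2 * pi * of_int (int a - int b))"
    using N by (simp add: x_def Complex.DeMoivre)
  also have "\<dots> = 1"
    by (rule cis_multiple_2pi) simp
  finally have xN: "x ^ N = 1" .
  show ?thesis
  proof (cases "a = b")
    case False
    have "x \<noteq> 1"
    proof
      assume "x = 1"
      then have "cos (2 * pi * (real a - real b) / real N) = 1"
        by (simp add: x_def cis.ctr complex_eq_iff)
      then obtain n :: int where "2 * pi * (real a - real b) / real N = of_int n * 2 * pi"
        by (auto simp: cos_one_2pi_int)
      then have "2 * pi * (real a - real b) = 2 * pi * (of_int n * real N)"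
        using N by (simp add: divide_simps mult_ac)
      then have "real a - real b = of_int n * real N"
        by (subst (asm) mult_cancel_left) simp
      then have "real_of_int (int a - int b) = of_int (n * int N)"
        by simp
      then have eq: "int a - int b = n * int N"
        by (simp only: of_int_eq_iff)
      have "\<bar>n\<bar> * int N < 1 * int N"
        using assms unfolding abs_mult[of n "int N", simplified, symmetric] eq[symmetric] by auto
      then have "n = 0"
        using N by (simp only: mult_less_cancel_right) auto
      then show False
        using eq False by auto
    qed
    then show ?thesis
      unfolding summand using False geometric_sum[of x N] xN by simp
  next
    case True
    then have "x = 1"
      by (simp add: x_def)
    with True show ?thesis
      unfolding summand by simp
  qed
qed

text \<open>The sum over the grid factors into one-variable sums, and a single coordinate in which
  \<open>k\<close> and \<open>l\<close> differ makes the product vanish.\<close>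

lemma sample_mean_character:
  assumes "k \<in> multi_box N" "l \<in> multi_box N"
  shows "sample_mean N (\<lambda>\<theta>. character N k \<theta> * cnj (character N l \<theta>)) = (if k = l then 1 else 0)"
proof -
  let ?e = "\<lambda>t. cis (2 * pi * real t / real N)"
  have N: "N > 0"
    using assms by (auto simp: multi_box_def intro: gr0I)
  have "(\<Sum>\<theta>\<in>(UNIV :: 'a set) \<rightarrow>\<^sub>E {..<N}. character N k \<theta> * cnj (character N l \<theta>))
      = (\<Sum>\<theta>\<in>(UNIV :: 'a set) \<rightarrow>\<^sub>E {..<N}. \<Prod>j\<in>UNIV. ?e (\<theta> j) ^ lkp k j * cnj (?e (\<theta> j) ^ lkp l j))"
    by (simp add: character_def prod.distrib)
  also have "\<dots> = (\<Prod>j\<in>(UNIV :: 'a set). \<Sum>t<N. ?e t ^ lkp k j * cnj (?e t ^ lkp l j))"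
    by (rule prod_sum_PiE[symmetric]) auto
  also have "\<dots> = (\<Prod>j\<in>(UNIV :: 'a set). if lkp k j = lkp l j then of_nat N else 0)"
    using assms by (intro prod.cong refl sum_roots_of_unity_powers) (auto simp: multi_box_def)
  also have "\<dots> = (if k = l then of_nat N ^ CARD('a) else 0)"
    by (auto simp: poly_mapping_eq_iff fun_eq_iff)
  finally show ?thesis
    using N by (simp add: sample_mean_def card_PiE scaleR_conv_of_real)
qed

section \<open>Recovering coefficients from sample means\<close>

lemma has_sum_finite_sum:
  fixes f :: "'i \<Rightarrow> 'a \<Rightarrow> 'b::topological_comm_monoid_add"
  assumes "\<And>i. i \<in> I \<Longrightarrow> (f i has_sum s i) A"
  shows "((\<lambda>x. \<Sum>i\<in>I. f i x) has_sum (\<Sum>i\<in>I. s i)) A"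
  using assms by (induction I rule: infinite_finite_induct) (auto intro: has_sum_add)

lemma has_sum_sample_mean:
  fixes u :: "('n::finite \<Rightarrow> nat) \<Rightarrow> 'a \<Rightarrow> complex"
  assumes "\<And>\<theta>. (u \<theta> has_sum s \<theta>) A"
  shows "((\<lambda>x. sample_mean N (\<lambda>\<theta>. u \<theta> x)) has_sum sample_mean N s) A"
  unfolding sample_mean_def scaleR_conv_of_real using assms
  by (intro has_sum_cmult_right has_sum_finite_sum) auto

lemma sample_point_in_polydisc:
  assumes "\<And>j. 0 \<le> r j \<and> r j < 1"
  shows "sample_point r N \<theta> \<in> polydisc"
  using assms by (simp add: polydisc_def sample_point_def norm_mult)

text \<open>Sampling may alias frequencies outside the box onto \<open>k\<close>, but the total
  aliasing error is at most the tail of an absolutely convergent series. Hence the discrete Fourier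
  coefficients converge to the true one.\<close>

lemma expands_coeff_limit:
  fixes k :: "'n::finite \<Rightarrow>\<^sub>0 nat"
  assumes "expands c f" and r: "\<And>j. 0 \<le> r j \<and> r j < 1"
  shows "(\<lambda>N. sample_mean N (\<lambda>\<theta>. f (sample_point r N \<theta>) * cnj (character N k \<theta>)))
    \<longlonglongrightarrow> c k * of_real (\<Prod>j\<in>UNIV. r j ^ lkp k j)"
proof -
  \<comment> \<open>These are the Fourier coefficients of \<open>f\<close> on the torus with radii
    \<open>r\<close>.\<close>
  define x where "x = (\<lambda>m. c m * of_real (\<Prod>j\<in>UNIV. r j ^ lkp m j))"
  define M where "M = (\<lambda>N. sample_mean N (\<lambda>\<theta>. f (sample_point r N \<theta>) * cnj (character N k \<theta>)))"
  have expand: "((\<lambda>m. x m * character N m \<theta>) has_sum f (sample_point r N \<theta>)) UNIV" for N \<theta>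
    using assms(1) sample_point_in_polydisc[of r N \<theta>] r
    by (auto simp: expands_def x_def monomial_at_sample_point mult.assoc)
  \<comment> \<open>Absolute summability can be read off at any one sample point, because characters
    have modulus 1; \<open>N = 1\<close> and \<open>\<theta> = 0\<close> are arbitrary
    choices.\<close>
  have "(\<lambda>m. norm (x m * character 1 m (\<lambda>_. 0))) summable_on UNIV"
    unfolding summable_on_iff_abs_summable_on_complex[symmetric]
    using expand[of 1 "\<lambda>_. 0"] by (rule has_sum_imp_summable)
  then have "((\<lambda>m. norm (x m)) has_sum (\<Sum>\<^sub>\<infinity>m. norm (x m))) UNIV"
    by (simp add: norm_mult)
  moreover define S where "S = (\<Sum>\<^sub>\<infinity>m. norm (x m))"
  ultimately have S: "((\<lambda>m. norm (x m)) has_sum S) UNIV"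
    by simp
  \<comment> \<open>The comparison is termwise. For \<open>m\<close> in the box orthogonality makes
    both sides zero; for \<open>m\<close> outside, the mean of the characters has modulus at most 1
    and \<open>norm (x m)\<close> remains. What is left is the tail of the series.\<close>
  have bound: "norm (M N - x k) \<le> S - (\<Sum>m\<in>multi_box N. norm (x m))" if k: "k \<in> multi_box N" for N
  proof (rule norm_infsum_le)
    let ?A = "\<lambda>m. sample_mean N (\<lambda>\<theta>. character N m \<theta> * cnj (character N k \<theta>))"
    have "((\<lambda>m. sample_mean N (\<lambda>\<theta>. x m * character N m \<theta> * cnj (character N k \<theta>))) has_sum M N) UNIV"
      unfolding M_def by (intro has_sum_sample_mean has_sum_cmult_left expand)
    then have "((\<lambda>m. x m * ?A m) has_sum M N) UNIV"
      by (simp add: mult.assoc sample_mean_mult_left)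
    moreover have "((\<lambda>m. if m = k then x k else 0) has_sum x k) UNIV"
      by (rule has_sum_finite_neutralI[of "{k}"]) auto
    ultimately have "((\<lambda>m. x m * ?A m + - (if m = k then x k else 0)) has_sum M N + - x k) UNIV"
      by (intro has_sum_add has_sum_uminusI)
    then show "((\<lambda>m. x m * ?A m - (if m = k then x k else 0)) has_sum M N - x k) UNIV"
      by simp
    have "((\<lambda>m. if m \<in> multi_box N then norm (x m) else 0) has_sum (\<Sum>m\<in>multi_box N. norm (x m))) UNIV"
      by (rule has_sum_finite_neutralI[of "multi_box N"]) auto
    then have "((\<lambda>m. norm (x m) + - (if m \<in> multi_box N then norm (x m) else 0))
        has_sum S + - (\<Sum>m\<in>multi_box N. norm (x m))) UNIV"
      by (intro has_sum_add has_sum_uminusI S)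
    then show "((\<lambda>m. norm (x m) - (if m \<in> multi_box N then norm (x m) else 0))
        has_sum S - (\<Sum>m\<in>multi_box N. norm (x m))) UNIV"
      by simp
    fix m
    show "norm (x m * ?A m - (if m = k then x k else 0))
        \<le> norm (x m) - (if m \<in> multi_box N then norm (x m) else 0)"
    proof (cases "m \<in> multi_box N")
      case True
      then show ?thesis
        using k by (auto simp: sample_mean_character)
    next
      case False
      have "norm (?A m) \<le> 1"
        by (intro norm_sample_mean_le) (auto simp: norm_mult)
      then have "norm (x m) * norm (?A m) \<le> norm (x m) * 1"
        by (intro mult_left_mono) auto
      then show ?thesis
        using False k by (auto simp: norm_mult)
    qed
  qed
  obtain N0 where N0: "{k} \<subseteq> multi_box N0"
    using finite_subset_multi_box[of "{k}"] by auto
  have "(\<lambda>N. \<Sum>m\<in>multi_box N. norm (x m)) \<longlonglongrightarrow> S"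
    using filterlim_compose[OF S[unfolded has_sum_def] filterlim_multi_box] .
  then have "(\<lambda>N. S - (\<Sum>m\<in>multi_box N. norm (x m))) \<longlonglongrightarrow> S - S"
    by (intro tendsto_diff tendsto_const)
  then have "(\<lambda>N. S - (\<Sum>m\<in>multi_box N. norm (x m))) \<longlonglongrightarrow> 0"
    by simp
  moreover have "\<forall>\<^sub>F N in sequentially. norm (M N - x k) \<le> S - (\<Sum>m\<in>multi_box N. norm (x m))"
    using N0 bound mono_multi_box unfolding eventually_sequentially by blast
  ultimately have "(\<lambda>N. M N - x k) \<longlonglongrightarrow> 0"
    by (rule Lim_null_comparison[rotated])
  then show ?thesis
    unfolding M_def x_def by (rule LIM_zero_cancel)
qed

text \<open>Both families arise as the same limit of sample means of \<open>f\<close>. The radius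
  1/2 is positive, so the factor multiplying the coefficient can be cancelled.\<close>

lemma expands_unique_coeff:
  fixes k :: "'n::finite \<Rightarrow>\<^sub>0 nat"
  assumes "expands c f" "expands d f"
  shows "c k = d k"
proof -
  have "c k * of_real (\<Prod>j\<in>UNIV. (1/2) ^ lkp k j) = d k * of_real (\<Prod>j\<in>UNIV. (1/2) ^ lkp k j)"
    using assms by (intro LIMSEQ_unique[OF expands_coeff_limit[of c f] expands_coeff_limit[of d f]]) auto
  then show ?thesis
    by simp
qed

section \<open>Discrete Parseval identity and Bessel inequality\<close>

lemma of_real_sample_mean:
  "complex_of_real (sample_mean N u) = sample_mean N (\<lambda>\<theta>. complex_of_real (u \<theta>))"
  by (simp add: sample_mean_def scaleR_conv_of_real)

lemma Re_sample_mean: "Re (sample_mean N u) = sample_mean N (\<lambda>\<theta>. Re (u \<theta>))"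
  by (simp add: sample_mean_def)

text \<open>Frequencies in the box have orthonormal characters, so in the expanded square only the
  diagonal terms survive.\<close>

lemma sample_mean_norm_sq:
  fixes B :: "('n::finite \<Rightarrow>\<^sub>0 nat) set"
  assumes "B \<subseteq> multi_box N"
  shows "sample_mean N (\<lambda>\<theta>. (norm (\<Sum>k\<in>B. b k * character N k \<theta>))\<^sup>2) = (\<Sum>k\<in>B. (norm (b k))\<^sup>2)"
proof -
  have fin: "finite B"
    by (rule finite_subset[OF assms]) simp
  have "complex_of_real (sample_mean N (\<lambda>\<theta>. (norm (\<Sum>k\<in>B. b k * character N k \<theta>))\<^sup>2))
      = sample_mean N (\<lambda>\<theta>. \<Sum>k\<in>B. \<Sum>l\<in>B. (b k * cnj (b l)) * (character N k \<theta> * cnj (character N l \<theta>)))"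
    unfolding of_real_sample_mean complex_norm_square cnj_sum sum_product
    by (simp add: mult_ac)
  also have "\<dots> = (\<Sum>k\<in>B. \<Sum>l\<in>B. (b k * cnj (b l)) *
      sample_mean N (\<lambda>\<theta>. character N k \<theta> * cnj (character N l \<theta>)))"
    by (simp only: sample_mean_sum sample_mean_mult_left)
  also have "\<dots> = (\<Sum>k\<in>B. \<Sum>l\<in>B. if l = k then b k * cnj (b l) else 0)"
    using assms by (intro sum.cong refl) (auto simp: sample_mean_character subset_iff)
  also have "\<dots> = complex_of_real (\<Sum>k\<in>B. (norm (b k))\<^sup>2)"
    using fin unfolding of_real_sum complex_norm_square by simp
  finally show ?thesis
    by (simp only: of_real_eq_iff)
qed

text \<open>The sum \<open>v\<close> is the orthogonal projection of \<open>u\<close> onto the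
  characters in \<open>B\<close>, so its inner product with \<open>u\<close> equals its own mean
  square \<open>S\<close>. Averaging \<open>2 * Re (u * cnj v) \<le> (norm u)^2 + (norm v)^2\<close>
  then leaves \<open>2 * S\<close> below the mean square of \<open>u\<close> plus
  \<open>S\<close>.\<close>

lemma sample_mean_bessel:
  fixes B :: "('n::finite \<Rightarrow>\<^sub>0 nat) set"
  assumes "B \<subseteq> multi_box N"
  shows "(\<Sum>k\<in>B. (norm (sample_mean N (\<lambda>\<theta>. u \<theta> * cnj (character N k \<theta>))))\<^sup>2)
    \<le> sample_mean N (\<lambda>\<theta>. (norm (u \<theta>))\<^sup>2)"
proof -
  define a where "a = (\<lambda>k. sample_mean N (\<lambda>\<theta>. u \<theta> * cnj (character N k \<theta>)))"
  define v where "v = (\<lambda>\<theta>. \<Sum>k\<in>B. a k * character N k \<theta>)"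
  define S where "S = (\<Sum>k\<in>B. (norm (a k))\<^sup>2)"
  have v: "sample_mean N (\<lambda>\<theta>. (norm (v \<theta>))\<^sup>2) = S"
    unfolding v_def S_def by (rule sample_mean_norm_sq[OF assms])
  have "sample_mean N (\<lambda>\<theta>. u \<theta> * cnj (v \<theta>))
      = sample_mean N (\<lambda>\<theta>. \<Sum>k\<in>B. cnj (a k) * (u \<theta> * cnj (character N k \<theta>)))"
    by (simp add: v_def sum_distrib_left mult_ac)
  also have "\<dots> = (\<Sum>k\<in>B. cnj (a k) * a k)"
    by (simp only: sample_mean_sum sample_mean_mult_left a_def)
  also have "\<dots> = of_real S"
    unfolding S_def of_real_sum complex_norm_square by (simp add: mult.commute)
  finally have "sample_mean N (\<lambda>\<theta>. Re (u \<theta> * cnj (v \<theta>))) = S"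
    by (metis Re_sample_mean Re_complex_of_real)
  then have "2 * S = sample_mean N (\<lambda>\<theta>. 2 * Re (u \<theta> * cnj (v \<theta>)))"
    by (simp only: sample_mean_mult_left)
  also have "\<dots> \<le> sample_mean N (\<lambda>\<theta>. (norm (u \<theta>))\<^sup>2 + (norm (v \<theta>))\<^sup>2)"
  proof (rule sample_mean_mono)
    fix \<theta>
    have "Re (u \<theta> * cnj (v \<theta>)) \<le> norm (u \<theta>) * norm (v \<theta>)"
      by (metis complex_Re_le_cmod complex_mod_cnj norm_mult)
    then show "2 * Re (u \<theta> * cnj (v \<theta>)) \<le> (norm (u \<theta>))\<^sup>2 + (norm (v \<theta>))\<^sup>2"
      using sum_squares_bound[of "norm (u \<theta>)" "norm (v \<theta>)"] by simp
  qed
  also have "\<dots> = sample_mean N (\<lambda>\<theta>. (norm (u \<theta>))\<^sup>2) + S"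
    by (simp add: sample_mean_add v)
  finally show ?thesis
    by (simp add: S_def a_def)
qed

text \<open>Bessel's inequality bounds the coefficients of \<open>G * h\<close> by its mean square
  on the torus, the bound on \<open>h\<close> reduces this to the mean square of \<open>G\<close>,
  and Parseval returns to the coefficients of \<open>G\<close>; then \<open>N\<close> tends to
  infinity.\<close>

lemma sum_norm_sq_cauchy_coeff_le:
  fixes c d :: "('n::finite \<Rightarrow>\<^sub>0 nat) \<Rightarrow> complex"
  assumes h: "expands d h" "\<And>z. z \<in> polydisc \<Longrightarrow> norm (h z) \<le> M"
    and r: "\<And>j. 0 \<le> r j \<and> r j < 1"
  shows "(\<Sum>k\<in>multi_box L. (norm (cauchy_coeff c d k) * (\<Prod>j\<in>UNIV. r j ^ lkp k j))\<^sup>2)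
    \<le> M\<^sup>2 * (\<Sum>k\<in>multi_box L. (norm (c k) * (\<Prod>j\<in>UNIV. r j ^ lkp k j))\<^sup>2)"
proof -
  define R where "R = (\<lambda>k :: 'n \<Rightarrow>\<^sub>0 nat. \<Prod>j\<in>UNIV. r j ^ lkp k j)"
  \<comment> \<open>Truncation makes \<open>G\<close> a polynomial with frequencies in the box, so
    Parseval is exact for it as soon as \<open>N \<ge> L\<close>.\<close>
  define c' where "c' = (\<lambda>k. if k \<in> multi_box L then c k else 0)"
  define G where "G = (\<lambda>z. \<Sum>k\<in>multi_box L. c' k * monomial_at k z)"
  have R: "R k \<ge> 0" for k
    using r by (auto simp: R_def intro: prod_nonneg)
  have "expands c' G"
    unfolding G_def by (rule expands_finite_support) (auto simp: c'_def)
  then have GH: "expands (cauchy_coeff c' d) (\<lambda>z. G z * h z)"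
    using h(1) by (rule expands_mult)
  \<comment> \<open>If \<open>a + b = k\<close> then \<open>a\<close> is at most \<open>k\<close> in
    every coordinate, so the coefficients of the product inside the box never see the
    truncation.\<close>
  have same: "cauchy_coeff c' d k = cauchy_coeff c d k" if "k \<in> multi_box L" for k
  proof -
    have "a \<in> multi_box L" if "a + b = k" for a b
      using \<open>k \<in> multi_box L\<close> that by (auto simp: multi_box_def lookup_add) (metis add_lessD1)
    then show ?thesis
      unfolding cauchy_coeff_def by (intro sum.cong) (auto simp: c'_def)
  qed
  define a where "a = (\<lambda>N k. sample_mean N (\<lambda>\<theta>. G (sample_point r N \<theta>) * h (sample_point r N \<theta>)
    * cnj (character N k \<theta>)))"
  have "(\<lambda>N. a N k) \<longlonglongrightarrow> cauchy_coeff c' d k * of_real (R k)" for k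
    unfolding a_def R_def by (rule expands_coeff_limit[OF GH r])
  then have "(\<lambda>N. \<Sum>k\<in>multi_box L. (norm (a N k))\<^sup>2)
      \<longlonglongrightarrow> (\<Sum>k\<in>multi_box L. (norm (cauchy_coeff c' d k * of_real (R k)))\<^sup>2)"
    by (intro tendsto_sum tendsto_power tendsto_norm)
  also have "(\<Sum>k\<in>multi_box L. (norm (cauchy_coeff c' d k * of_real (R k)))\<^sup>2)
      = (\<Sum>k\<in>multi_box L. (norm (cauchy_coeff c d k) * R k)\<^sup>2)"
    using R by (intro sum.cong) (auto simp: same norm_mult)
  finally have lim: "(\<lambda>N. \<Sum>k\<in>multi_box L. (norm (a N k))\<^sup>2)
      \<longlonglongrightarrow> (\<Sum>k\<in>multi_box L. (norm (cauchy_coeff c d k) * R k)\<^sup>2)" .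
  have "(\<Sum>k\<in>multi_box L. (norm (a N k))\<^sup>2) \<le> M\<^sup>2 * (\<Sum>k\<in>multi_box L. (norm (c k) * R k)\<^sup>2)"
    if "N \<ge> L" for N
  proof -
    have sub: "(multi_box L :: ('n \<Rightarrow>\<^sub>0 nat) set) \<subseteq> multi_box N"
      using that by (rule mono_multi_box)
    have "(\<Sum>k\<in>multi_box L. (norm (a N k))\<^sup>2)
        \<le> sample_mean N (\<lambda>\<theta>. (norm (G (sample_point r N \<theta>) * h (sample_point r N \<theta>)))\<^sup>2)"
      unfolding a_def by (rule sample_mean_bessel[OF sub])
    also have "\<dots> \<le> sample_mean N (\<lambda>\<theta>. M\<^sup>2 * (norm (G (sample_point r N \<theta>)))\<^sup>2)"
    proof (rule sample_mean_mono)
      fix \<theta>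
      have "(norm (h (sample_point r N \<theta>)))\<^sup>2 \<le> M\<^sup>2"
        using h(2) sample_point_in_polydisc[of r N \<theta>] r by (intro power_mono) auto
      then show "(norm (G (sample_point r N \<theta>) * h (sample_point r N \<theta>)))\<^sup>2
          \<le> M\<^sup>2 * (norm (G (sample_point r N \<theta>)))\<^sup>2"
        unfolding norm_mult power_mult_distrib mult.commute[of "(norm (G _))\<^sup>2"]
        by (rule mult_right_mono) simp
    qed
    also have "\<dots> = M\<^sup>2 * sample_mean N (\<lambda>\<theta>. (norm (\<Sum>k\<in>multi_box L. (c' k * of_real (R k)) * character N k \<theta>))\<^sup>2)"
      by (simp add: sample_mean_mult_left G_def monomial_at_sample_point R_def mult.assoc)
    also have "\<dots> = M\<^sup>2 * (\<Sum>k\<in>multi_box L. (norm (c' k * of_real (R k)))\<^sup>2)"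
      by (simp only: sample_mean_norm_sq[OF sub])
    also have "(\<Sum>k\<in>multi_box L. (norm (c' k * of_real (R k)))\<^sup>2)
        = (\<Sum>k\<in>multi_box L. (norm (c k) * R k)\<^sup>2)"
      using R by (intro sum.cong) (auto simp: c'_def norm_mult)
    finally show ?thesis .
  qed
  then have "(\<Sum>k\<in>multi_box L. (norm (cauchy_coeff c d k) * R k)\<^sup>2)
      \<le> M\<^sup>2 * (\<Sum>k\<in>multi_box L. (norm (c k) * R k)\<^sup>2)"
    by (intro LIMSEQ_le_const2[OF lim]) blast
  then show ?thesis
    by (simp only: R_def)
qed

subsection \<open>Bounded multipliers\<close>

definition dirichlet_weight :: "real \<Rightarrow> ('n::finite \<Rightarrow>\<^sub>0 nat) \<Rightarrow> real" where
  "dirichlet_weight \<beta> k = (\<Prod>j\<in>UNIV. (1 + real (lkp k j)) powr \<beta>)"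

lemma dirichlet_weight_nonneg [simp]: "dirichlet_weight \<beta> k \<ge> 0"
  by (simp add: dirichlet_weight_def prod_nonneg)

text \<open>The torus estimates say that the polynomial in \<open>t\<close> with coefficients
  \<open>a k\<close> is nonnegative on the open cube (0,1)^n; the mixture argument exchanges the
  powers of \<open>t\<close> for the Dirichlet weights.\<close>

lemma weighted_sum_cauchy_coeff_le:
  fixes c d :: "('n::finite \<Rightarrow>\<^sub>0 nat) \<Rightarrow> complex"
  assumes h: "expands d h" "\<And>z. z \<in> polydisc \<Longrightarrow> norm (h z) \<le> M" and "\<alpha> < 0"
  shows "(\<Sum>k\<in>multi_box L. dirichlet_weight \<alpha> k * (norm (cauchy_coeff c d k))\<^sup>2)
    \<le> M\<^sup>2 * (\<Sum>k\<in>multi_box L. dirichlet_weight \<alpha> k * (norm (c k))\<^sup>2)"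
proof -
  define a where "a = (\<lambda>k. M\<^sup>2 * (norm (c k))\<^sup>2 - (norm (cauchy_coeff c d k))\<^sup>2)"
  have "(\<Sum>k\<in>multi_box L. a k * (\<Prod>j\<in>UNIV. (1 + real (lkp k j)) powr \<alpha>)) \<ge> 0"
  proof (rule sum_prod_powr_nonneg_of_sum_prod_power_nonneg[OF \<open>\<alpha> < 0\<close>])
    fix t :: "'n \<Rightarrow> real"
    assume t: "\<And>j. 0 < t j \<and> t j < 1"
    \<comment> \<open>Square roots, because the torus estimate carries the squares of the
      radii.\<close>
    define r where "r = (\<lambda>j. sqrt (t j))"
    have "(r j ^ m)\<^sup>2 = t j ^ m" for j m
      using t[of j] by (simp add: r_def less_imp_le power_mult power_even_eq flip: real_sqrt_power)
    then have "(\<Prod>j\<in>UNIV. r j ^ lkp k j)\<^sup>2 = (\<Prod>j\<in>UNIV. t j ^ lkp k j)" for k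
      by (simp add: prod_power_distrib)
    then have sq: "(x * (\<Prod>j\<in>UNIV. r j ^ lkp k j))\<^sup>2 = x\<^sup>2 * (\<Prod>j\<in>UNIV. t j ^ lkp k j)" for x k
      by (simp add: power_mult_distrib)
    have "0 \<le> r j \<and> r j < 1" for j
      using t[of j] by (simp add: r_def less_imp_le real_sqrt_lt_1_iff)
    from sum_norm_sq_cauchy_coeff_le[where r = r and L = L and c = c, OF h this]
    show "0 \<le> (\<Sum>k\<in>multi_box L. a k * (\<Prod>j\<in>UNIV. t j ^ lkp k j))"
      unfolding sq by (simp add: a_def sum_subtractf sum_distrib_left algebra_simps)
  qed
  then show ?thesis
    by (simp add: a_def dirichlet_weight_def sum_subtractf sum_distrib_left algebra_simps)
qed

text \<open>The box estimate is uniform in \<open>L\<close>: its right-hand side stays below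
  \<open>M^2\<close> times the full weighted sum of \<open>c\<close>. Every finite set of indices
  lies in some box, so the partial sums are bounded.\<close>

lemma summable_weighted_cauchy_coeff:
  fixes c d :: "('n::finite \<Rightarrow>\<^sub>0 nat) \<Rightarrow> complex"
  assumes h: "expands d h" "\<And>z. z \<in> polydisc \<Longrightarrow> norm (h z) \<le> M" and "\<alpha> < 0"
    and c: "(\<lambda>k. dirichlet_weight \<alpha> k * (norm (c k))\<^sup>2) summable_on UNIV"
  shows "(\<lambda>k. dirichlet_weight \<alpha> k * (norm (cauchy_coeff c d k))\<^sup>2) summable_on UNIV"
proof (rule nonneg_bdd_above_summable_on)
  let ?S = "\<Sum>\<^sub>\<infinity>k. dirichlet_weight \<alpha> k * (norm (c k))\<^sup>2"
  have "sum (\<lambda>k. dirichlet_weight \<alpha> k * (norm (cauchy_coeff c d k))\<^sup>2) F \<le> M\<^sup>2 * ?S" if "finite F" for F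
  proof -
    obtain L where L: "F \<subseteq> multi_box L"
      using finite_subset_multi_box[OF \<open>finite F\<close>] .
    have "sum (\<lambda>k. dirichlet_weight \<alpha> k * (norm (cauchy_coeff c d k))\<^sup>2) F
        \<le> sum (\<lambda>k. dirichlet_weight \<alpha> k * (norm (cauchy_coeff c d k))\<^sup>2) (multi_box L)"
      using L by (intro sum_mono2) auto
    also have "\<dots> \<le> M\<^sup>2 * (\<Sum>k\<in>multi_box L. dirichlet_weight \<alpha> k * (norm (c k))\<^sup>2)"
      by (rule weighted_sum_cauchy_coeff_le[OF h \<open>\<alpha> < 0\<close>])
    also have "\<dots> \<le> M\<^sup>2 * ?S"
      by (intro mult_left_mono finite_sum_le_infsum c) auto
    finally show ?thesis .
  qed
  then show "bdd_above (sum (\<lambda>k. dirichlet_weight \<alpha> k * (norm (cauchy_coeff c d k))\<^sup>2) ` {F. F \<subseteq> UNIV \<and> finite F})"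
    by (intro bdd_aboveI2[where M = "M\<^sup>2 * ?S"]) auto
qed auto

subsection \<open>The reflection is dominated by the polynomial\<close>

lemma holomorphic_on_poly_at_comp:
  fixes w :: "complex \<Rightarrow> complex ^ 'n::finite"
  assumes "\<And>i. (\<lambda>\<zeta>. w \<zeta> $ i) holomorphic_on A"
  shows "(\<lambda>\<zeta>. poly_at p (w \<zeta>)) holomorphic_on A"
  unfolding poly_at_def monomial_at_def using assms
  by (intro holomorphic_on_sum holomorphic_on_mult holomorphic_on_prod holomorphic_on_power
      holomorphic_on_const)

text \<open>Coordinates are released from the unit circle one at a time: with all others frozen, the
  one-variable maximum principle in coordinate \<open>j\<close> bounds the value inside the disc by
  the values on its boundary. In the induction \<open>S\<close> is the set of released
  coordinates.\<close>

lemma maximum_modulus_polydisc: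
  fixes F :: "complex ^ 'n::finite \<Rightarrow> complex"
  assumes hol: "\<And>z j. (\<And>i. norm (z $ i) \<le> 1) \<Longrightarrow>
      (\<lambda>\<zeta>. F (\<chi> i. if i = j then \<zeta> else z $ i)) holomorphic_on cball 0 1"
    and torus: "\<And>z. (\<And>i. norm (z $ i) = 1) \<Longrightarrow> norm (F z) \<le> B"
    and z: "\<And>i. norm (z $ i) \<le> 1"
  shows "norm (F z) \<le> B"
proof -
  have "\<forall>z. (\<forall>i. norm (z $ i) \<le> 1) \<longrightarrow> (\<forall>i. i \<notin> S \<longrightarrow> norm (z $ i) = 1) \<longrightarrow> norm (F z) \<le> B"
    if "finite S" for S
    using that
  proof (induction S)
    case empty
    then show ?case
      using torus by simp
  next
    case (insert j S)
    show ?case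
    proof (intro allI impI)
      fix z :: "complex ^ 'n"
      assume z: "\<forall>i. norm (z $ i) \<le> 1" and on: "\<forall>i. i \<notin> insert j S \<longrightarrow> norm (z $ i) = 1"
      define w where "w = (\<lambda>\<zeta>. \<chi> i. if i = j then \<zeta> else z $ i)"
      have hol': "(\<lambda>\<zeta>. F (w \<zeta>)) holomorphic_on cball 0 1"
        unfolding w_def using hol z by blast
      have "norm (F (w (z $ j))) \<le> B"
      proof (rule maximum_modulus_frontier[where S = "cball 0 1" and f = "\<lambda>\<zeta>. F (w \<zeta>)" and \<xi> = "z $ j"])
        show "(\<lambda>\<zeta>. F (w \<zeta>)) holomorphic_on interior (cball 0 1)"
          using hol' by (rule holomorphic_on_subset) (simp add: interior_subset)
        show "continuous_on (closure (cball 0 1)) (\<lambda>\<zeta>. F (w \<zeta>))"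
          using holomorphic_on_imp_continuous_on[OF hol'] by simp
        show "norm (F (w \<zeta>)) \<le> B" if "\<zeta> \<in> frontier (cball 0 1)" for \<zeta>
        proof -
          have "norm \<zeta> = 1"
            using that by (simp add: frontier_cball)
          then show ?thesis
            using insert.IH z on by (simp add: w_def)
        qed
        show "z $ j \<in> cball 0 1"
          using z by simp
      qed simp
      moreover have "w (z $ j) = z"
        by (simp add: w_def vec_eq_iff)
      ultimately show "norm (F z) \<le> B"
        by simp
    qed
  qed
  from this[of UNIV] show ?thesis
    using z by simp
qed

lemma monomial_at_scaleR:
  "monomial_at k (s *\<^sub>R z) = of_real (s ^ (\<Sum>j\<in>UNIV. lkp k j)) * monomial_at k z"
  by (simp add: monomial_at_def power_mult_distrib prod.distrib power_sum scaleR_conv_of_real[where 'a = complex])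

lemma norm_monomial_at_torus:
  "(\<And>i. norm (z $ i) = 1) \<Longrightarrow> norm (monomial_at k z) = 1"
  unfolding monomial_at_def prod_norm[symmetric] by (simp add: norm_power)

lemma norm_monomial_at_le:
  "(\<And>i. norm (z $ i) \<le> 1) \<Longrightarrow> norm (monomial_at k z) \<le> 1"
  unfolding monomial_at_def prod_norm[symmetric] by (intro prod_le_1) (simp add: norm_power power_le_one)

text \<open>On the torus the reflection and the polynomial have equal modulus, so the maximum
  principle bounds their quotient by 1. Since \<open>p\<close> may vanish on the torus, the argument
  runs for the dilations with \<open>s < 1\<close> and ends with the limit
  \<open>s \<rightarrow> 1\<close>.\<close>

lemma norm_reflection_le:
  fixes p :: "'n::finite cpoly"
  assumes nz: "\<And>z. z \<in> polydisc \<Longrightarrow> poly_at p z \<noteq> 0" and z: "z \<in> polydisc"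
  shows "norm (poly_at (reflection p) z) \<le> norm (poly_at p z)"
proof -
  \<comment> \<open>\<open>R s\<close> is the reflection of the dilated polynomial \<open>z \<mapsto> p (s z)\<close>, which has no zeros on the closed polydisc.\<close>
  define R :: "real \<Rightarrow> 'n cpoly" where "R = (\<lambda>s. \<Sum>k\<in>Poly_Mapping.keys p.
    Poly_Mapping.single (multidegree p - k) (cnj (lkp p k) * of_real (s ^ (\<Sum>j\<in>UNIV. lkp k j))))"
  have R_at: "poly_at (R s) w = (\<Sum>k\<in>Poly_Mapping.keys p.
      cnj (lkp p k) * of_real (s ^ (\<Sum>j\<in>UNIV. lkp k j)) * monomial_at (multidegree p - k) w)" for s w
    by (simp add: R_def poly_at_sum)
  have p_at: "poly_at p (s *\<^sub>R w) = (\<Sum>k\<in>Poly_Mapping.keys p.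
      lkp p k * (of_real (s ^ (\<Sum>j\<in>UNIV. lkp k j)) * monomial_at k w))" for s w
    by (simp add: poly_at_def monomial_at_scaleR)
  have "norm (poly_at (R s) z) \<le> norm (poly_at p (s *\<^sub>R z))" if s: "0 < s" "s < 1" for s
  proof -
    have in_disc: "s *\<^sub>R w \<in> polydisc" if "\<And>i. norm (w $ i) \<le> 1" for w :: "complex ^ 'n"
    proof -
      have "s * norm (w $ i) \<le> s * 1" for i
        using that s by (intro mult_left_mono) auto
      then have "s * norm (w $ i) < 1" for i
        using s by (metis le_less_trans mult.right_neutral)
      then show ?thesis
        using s by (simp add: polydisc_def)
    qed
    have "norm (poly_at (R s) z / poly_at p (s *\<^sub>R z)) \<le> 1"
    proof (rule maximum_modulus_polydisc[where F = "\<lambda>w. poly_at (R s) w / poly_at p (s *\<^sub>R w)"])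
      fix w :: "complex ^ 'n" and j :: 'n
      assume w: "\<And>i. norm (w $ i) \<le> 1"
      have coord: "(\<lambda>\<zeta>. if i = j then \<zeta> else w $ i) holomorphic_on cball 0 1" for i
        by (cases "i = j") (auto intro: holomorphic_intros)
      show "(\<lambda>\<zeta>. poly_at (R s) (\<chi> i. if i = j then \<zeta> else w $ i)
          / poly_at p (s *\<^sub>R (\<chi> i. if i = j then \<zeta> else w $ i))) holomorphic_on cball 0 1"
      proof (intro holomorphic_on_divide holomorphic_on_poly_at_comp)
        fix i
        show "(\<lambda>\<zeta>. (\<chi> i. if i = j then \<zeta> else w $ i) $ i) holomorphic_on cball 0 1"
          using coord by simp
        show "(\<lambda>\<zeta>. (s *\<^sub>R (\<chi> i. if i = j then \<zeta> else w $ i)) $ i) holomorphic_on cball 0 1"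
          using holomorphic_on_mult[OF holomorphic_on_const coord, of "of_real s"]
          by (simp add: scaleR_conv_of_real[where 'a = complex])
      next
        fix \<zeta> :: complex
        assume "\<zeta> \<in> cball 0 1"
        then show "poly_at p (s *\<^sub>R (\<chi> i. if i = j then \<zeta> else w $ i)) \<noteq> 0"
          using w by (intro nz in_disc) auto
      qed
    next
      fix w :: "complex ^ 'n"
      assume w: "\<And>i. norm (w $ i) = 1"
      have unit: "monomial_at k w * cnj (monomial_at k w) = 1" for k
        using norm_monomial_at_torus[OF w, of k] by (simp flip: complex_norm_square)
      \<comment> \<open>Conjugation inverts a monomial of modulus 1. The truncated subtraction is
        genuine because every exponent in \<open>p\<close> is bounded by the multidegree.\<close>
      have reflect: "monomial_at (multidegree p - k) w = monomial_at (multidegree p) w * cnj (monomial_at k w)"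
        if "k \<in> Poly_Mapping.keys p" for k
      proof -
        have "multidegree p - k + k = multidegree p"
          using lookup_le_degree_in[OF that] by (intro poly_mapping_eqI) (simp add: lookup_add lookup_minus)
        then have "monomial_at (multidegree p) w = monomial_at (multidegree p - k) w * monomial_at k w"
          by (metis monomial_at_add)
        then show ?thesis
          by (simp add: mult.assoc unit)
      qed
      have "poly_at (R s) w = monomial_at (multidegree p) w * cnj (poly_at p (s *\<^sub>R w))"
        unfolding R_at p_at cnj_sum sum_distrib_left
        by (intro sum.cong refl) (simp add: reflect mult_ac)
      then have "norm (poly_at (R s) w) = norm (poly_at p (s *\<^sub>R w))"
        by (simp add: norm_mult norm_monomial_at_torus[OF w])
      then show "norm (poly_at (R s) w / poly_at p (s *\<^sub>R w)) \<le> 1"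
        by (simp add: norm_divide)
    qed (use z in \<open>auto simp: polydisc_def less_imp_le\<close>)
    moreover have "poly_at p (s *\<^sub>R z) \<noteq> 0"
      using z by (intro nz in_disc) (auto simp: polydisc_def less_imp_le)
    ultimately show ?thesis
      by (simp add: norm_divide divide_simps)
  qed
  then have "\<forall>\<^sub>F s in at_left 1. norm (poly_at (R s) z) \<le> norm (poly_at p (s *\<^sub>R z))"
    using eventually_at_left_real[of 0 1] by (auto elim: eventually_mono)
  moreover have "((\<lambda>s. norm (poly_at (R s) z)) \<longlongrightarrow> norm (poly_at (R 1) z)) (at_left 1)"
    unfolding R_at by (intro tendsto_intros)
  moreover have "((\<lambda>s. norm (poly_at p (s *\<^sub>R z))) \<longlongrightarrow> norm (poly_at p (1 *\<^sub>R z))) (at_left 1)"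
    unfolding p_at by (intro tendsto_intros)
  ultimately have "norm (poly_at (R 1) z) \<le> norm (poly_at p (1 *\<^sub>R z))"
    by (intro tendsto_le[of "at_left (1::real)"]) auto
  moreover have "R 1 = reflection p"
    by (simp add: R_def reflection_def)
  ultimately show ?thesis
    by simp
qed

subsection \<open>Holomorphy of polynomials\<close>

lemma holomorphic_several_on_const: "holomorphic_several_on (\<lambda>z. c) S"
  unfolding holomorphic_several_on_def
proof
  fix z
  show "\<exists>A. ((\<lambda>z. c) has_derivative (\<lambda>h. \<Sum>j\<in>UNIV. A $ j * h $ j)) (at z within S)"
    by (rule exI[of _ 0]) simp
qed

lemma holomorphic_several_on_coordinate: "holomorphic_several_on (\<lambda>z. z $ i) S"
  unfolding holomorphic_several_on_def
proof
  fix z :: "complex ^ 'a"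
  have "(\<lambda>h :: complex ^ 'a. \<Sum>j\<in>UNIV. axis i 1 $ j * h $ j) = (\<lambda>h. h $ i)"
    by (simp add: axis_def if_distrib[of "\<lambda>x. x * _"] cong: if_cong)
  then show "\<exists>A. ((\<lambda>z. z $ i) has_derivative (\<lambda>h. \<Sum>j\<in>UNIV. A $ j * h $ j)) (at z within S)"
    using bounded_linear_imp_has_derivative[OF bounded_linear_vec_nth[of i]]
    by (intro exI[of _ "axis i 1"]) simp
qed

lemma holomorphic_several_on_add:
  assumes "holomorphic_several_on f S" "holomorphic_several_on g S"
  shows "holomorphic_several_on (\<lambda>z. f z + g z) S"
  unfolding holomorphic_several_on_def
proof
  fix z assume "z \<in> S"
  then obtain A B where "(f has_derivative (\<lambda>h. \<Sum>j\<in>UNIV. A $ j * h $ j)) (at z within S)"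
    "(g has_derivative (\<lambda>h. \<Sum>j\<in>UNIV. B $ j * h $ j)) (at z within S)"
    using assms unfolding holomorphic_several_on_def by blast
  from has_derivative_add[OF this]
  show "\<exists>A. ((\<lambda>z. f z + g z) has_derivative (\<lambda>h. \<Sum>j\<in>UNIV. A $ j * h $ j)) (at z within S)"
    by (intro exI[of _ "A + B"]) (simp add: distrib_right sum.distrib)
qed

lemma holomorphic_several_on_mult:
  assumes "holomorphic_several_on f S" "holomorphic_several_on g S"
  shows "holomorphic_several_on (\<lambda>z. f z * g z) S"
  unfolding holomorphic_several_on_def
proof
  fix z assume "z \<in> S"
  then obtain A B where "(f has_derivative (\<lambda>h. \<Sum>j\<in>UNIV. A $ j * h $ j)) (at z within S)"
    "(g has_derivative (\<lambda>h. \<Sum>j\<in>UNIV. B $ j * h $ j)) (at z within S)"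
    using assms unfolding holomorphic_several_on_def by blast
  from has_derivative_mult[OF this]
  show "\<exists>A. ((\<lambda>z. f z * g z) has_derivative (\<lambda>h. \<Sum>j\<in>UNIV. A $ j * h $ j)) (at z within S)"
    by (intro exI[of _ "\<chi> j. f z * B $ j + A $ j * g z"])
      (simp add: sum.distrib sum_distrib_left algebra_simps)
qed

lemma holomorphic_several_on_poly_at: "holomorphic_several_on (poly_at p) S"
proof -
  have power: "holomorphic_several_on (\<lambda>z. (z $ i) ^ m) S" for i :: 'a and m
    by (induction m) (auto intro: holomorphic_several_on_const holomorphic_several_on_mult
        holomorphic_several_on_coordinate)
  have "holomorphic_several_on (\<lambda>z. \<Prod>j\<in>J. (z $ j) ^ lkp k j) S" if "finite J" for J and k :: "'a \<Rightarrow>\<^sub>0 nat"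
    using that by (induction J) (auto intro: holomorphic_several_on_const holomorphic_several_on_mult power)
  then have monomial: "holomorphic_several_on (monomial_at k) S" for k :: "'a \<Rightarrow>\<^sub>0 nat"
    unfolding monomial_at_def by simp
  have "holomorphic_several_on (\<lambda>z. \<Sum>k\<in>K. lkp p k * monomial_at k z) S" if "finite K" for K
    using that by (induction K) (auto intro!: holomorphic_several_on_add monomial
        holomorphic_several_on_const holomorphic_several_on_mult[OF holomorphic_several_on_const])
  then show ?thesis
    unfolding poly_at_def by simp
qed

subsection \<open>The Euler operator\<close>

text \<open>Coefficients of \<open>z\<^sub>j \<partial>f/\<partial>z\<^sub>j\<close>.\<close>

definition euler_coeff :: "'n \<Rightarrow> (('n::finite \<Rightarrow>\<^sub>0 nat) \<Rightarrow> complex) \<Rightarrow> ('n \<Rightarrow>\<^sub>0 nat) \<Rightarrow> complex" where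
  "euler_coeff j c k = of_nat (lkp k j) * c k"

text \<open>The Leibniz rule: \<open>lkp k j = lkp a j + lkp b j\<close> on the fibre
  \<open>a + b = k\<close>.\<close>

lemma euler_coeff_cauchy_coeff:
  "euler_coeff j (cauchy_coeff c d) k
    = cauchy_coeff (euler_coeff j c) d k + cauchy_coeff c (euler_coeff j d) k"
  unfolding cauchy_coeff_def euler_coeff_def sum_distrib_left sum.distrib[symmetric]
  by (intro sum.cong) (auto simp: lookup_add algebra_simps)

text \<open>The growth of the factor \<open>lkp k j\<close> is absorbed by comparing with a point
  whose coordinate \<open>j\<close> has slightly larger modulus. Only the existence of a sum is
  asserted; the main proof computes \<open>F\<close> from its product with \<open>p\<close>.\<close>

lemma expands_euler_coeff:
  fixes c :: "('n::finite \<Rightarrow>\<^sub>0 nat) \<Rightarrow> complex"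
  assumes "expands c f"
  obtains F where "expands (euler_coeff j c) F"
proof -
  have "(\<lambda>k. euler_coeff j c k * monomial_at k z) summable_on UNIV" if z: "z \<in> polydisc" for z
  proof -
    obtain \<rho> where \<rho>: "norm (z $ j) < \<rho>" "\<rho> < 1"
      using z dense unfolding polydisc_def by blast
    then have "\<rho> > 0"
      by (meson le_less_trans norm_ge_zero)
    \<comment> \<open>Only coordinate \<open>j\<close> changes, so in modulus a monomial at
      \<open>z\<close> is \<open>x ^ lkp k j\<close> times the one at \<open>w\<close>, where
      \<open>x < 1\<close> and hence \<open>real n * x ^ n\<close> is bounded in
      \<open>n\<close>.\<close>
    define w where "w = (\<chi> i. if i = j then of_real \<rho> else z $ i)"
    have "w \<in> polydisc"
      using z \<rho> \<open>\<rho> > 0\<close> by (auto simp: polydisc_def w_def)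
    then have "((\<lambda>k. c k * monomial_at k w) has_sum f w) UNIV"
      using assms by (simp add: expands_def)
    then have summable: "(\<lambda>k. norm (c k * monomial_at k w)) summable_on UNIV"
      unfolding summable_on_iff_abs_summable_on_complex[symmetric] by (rule has_sum_imp_summable)
    define x where "x = norm (z $ j) / \<rho>"
    have x: "0 \<le> x" "x < 1"
      using \<rho> \<open>\<rho> > 0\<close> by (simp_all add: x_def)
    then have "(\<lambda>n. real n * x ^ n) \<longlonglongrightarrow> 0"
      by (intro powser_times_n_limit_0) auto
    then have "Bseq (\<lambda>n. real n * x ^ n)"
      by (intro convergent_imp_Bseq convergentI)
    then obtain K where K: "\<And>n. norm (real n * x ^ n) \<le> K"
      by (auto simp: Bseq_def)
    have mon: "norm (monomial_at k z) = x ^ lkp k j * norm (monomial_at k w)" for k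
    proof -
      have split: "norm (monomial_at k u)
          = norm (u $ j) ^ lkp k j * (\<Prod>i\<in>UNIV - {j}. norm (u $ i) ^ lkp k i)" for u :: "complex ^ 'n"
        unfolding monomial_at_def prod_norm[symmetric] norm_power by (intro prod.remove) auto
      have "(\<Prod>i\<in>UNIV - {j}. norm (w $ i) ^ lkp k i) = (\<Prod>i\<in>UNIV - {j}. norm (z $ i) ^ lkp k i)"
        by (intro prod.cong) (auto simp: w_def)
      then show ?thesis
        using \<open>\<rho> > 0\<close> by (simp add: split w_def x_def power_divide)
    qed
    have "(\<lambda>k. norm (euler_coeff j c k * monomial_at k z)) summable_on UNIV"
    proof (rule Infinite_Sum.abs_summable_on_comparison_test')
      show "(\<lambda>k. K * norm (c k * monomial_at k w)) summable_on UNIV"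
        by (rule summable_on_cmult_right[OF summable])
      fix k
      have "norm (euler_coeff j c k * monomial_at k z)
          = (real (lkp k j) * x ^ lkp k j) * norm (c k * monomial_at k w)"
        by (simp add: euler_coeff_def norm_mult mon)
      also have "\<dots> \<le> K * norm (c k * monomial_at k w)"
        using K[of "lkp k j"] x by (intro mult_right_mono) auto
      finally show "norm (euler_coeff j c k * monomial_at k z) \<le> K * norm (c k * monomial_at k w)" .
    qed
    then show ?thesis
      by (rule abs_summable_summable)
  qed
  then have "expands (euler_coeff j c) (\<lambda>z. \<Sum>\<^sub>\<infinity>k. euler_coeff j c k * monomial_at k z)"
    unfolding expands_def by (blast intro: has_sum_infsum)
  then show ?thesis
    by (rule that)
qed

lemma expands_finite_support_bounded:
  assumes "finite A" "\<And>k. k \<notin> A \<Longrightarrow> c k = 0"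
  obtains f M where "expands c f" "\<And>z. z \<in> polydisc \<Longrightarrow> norm (f z) \<le> M"
proof (rule that)
  show "expands c (\<lambda>z. \<Sum>k\<in>A. c k * monomial_at k z)"
    using assms by (rule expands_finite_support)
  fix z :: "complex ^ 'a"
  assume "z \<in> polydisc"
  then have mon: "norm (monomial_at k z) \<le> 1" for k
    by (intro norm_monomial_at_le) (auto simp: polydisc_def less_imp_le)
  show "norm (\<Sum>k\<in>A. c k * monomial_at k z) \<le> (\<Sum>k\<in>A. norm (c k))"
    using mon by (intro sum_norm_le) (simp add: norm_mult mult_left_le)
qed

text \<open>Multiplying coefficients by \<open>lkp k j\<close> keeps the support inside
  \<open>Poly_Mapping.keys p\<close>, so the result is again a polynomial.\<close>

lemma euler_coeff_poly_bounded:
  fixes p :: "'n::finite cpoly"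
  obtains f M where "expands (euler_coeff j (lkp p)) f" "\<And>z. z \<in> polydisc \<Longrightarrow> norm (f z) \<le> M"
  by (rule expands_finite_support_bounded[of "Poly_Mapping.keys p" "euler_coeff j (lkp p)"])
    (auto simp: euler_coeff_def in_keys_iff)

lemma dirichlet_weight_add: "dirichlet_weight (\<alpha> + \<beta>) k = dirichlet_weight \<alpha> k * dirichlet_weight \<beta> k"
  by (simp add: dirichlet_weight_def powr_add prod.distrib)

section \<open>Gain of smoothness for the inner function\<close>

theorem theorem2:
  fixes p :: "'n::finite cpoly" and \<alpha> :: real
  assumes "atoral p"
    and "\<And>z. z \<in> polydisc \<Longrightarrow> poly_at p z \<noteq> 0"
    and "\<alpha> < 0"
    and "(\<lambda>z. 1 / poly_at p z) \<in> dirichlet_space \<alpha>"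
  shows "rational_inner p \<in> dirichlet_space (\<alpha> + 2 / real CARD('n))"
proof -
  note nz = assms(2)
  let ?pt = "reflection p"
  from assms(4) obtain g where hol: "holomorphic_several_on (\<lambda>z. 1 / poly_at p z) polydisc"
    and g: "expands g (\<lambda>z. 1 / poly_at p z)"
    and g_sum: "(\<lambda>k. dirichlet_weight \<alpha> k * (norm (g k))\<^sup>2) summable_on UNIV"
    unfolding dirichlet_space_def expands_def dirichlet_weight_def by auto
  \<comment> \<open>Defining \<open>\<phi>\<close> as a Cauchy product with \<open>g\<close> makes
    the multiplier estimate directly applicable, with the reflection as bounded factor.\<close>
  define \<phi> where "\<phi> = cauchy_coeff g (lkp ?pt)"
  have "expands \<phi> (\<lambda>z. 1 / poly_at p z * poly_at ?pt z)"
    unfolding \<phi>_def by (intro expands_mult g expands_poly_at)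
  then have \<phi>: "expands \<phi> (rational_inner p)"
    by (rule expands_cong) (simp add: rational_inner_def)
  have inner_le: "norm (rational_inner p z) \<le> 1" if "z \<in> polydisc" for z
    using norm_reflection_le[OF nz that] nz[OF that]
    by (simp add: rational_inner_def norm_divide divide_simps)
  have "\<And>z. z \<in> polydisc \<Longrightarrow> poly_at p z * rational_inner p z = poly_at ?pt z"
    using nz by (simp add: rational_inner_def)
  then have "expands (cauchy_coeff (lkp p) \<phi>) (poly_at ?pt)"
    using expands_cong[OF expands_mult[OF expands_poly_at \<phi>]] by blast
  \<comment> \<open>The relation between \<open>p\<close>, the inner function and the reflection is
    moved to coefficients, where the Leibniz rule is available.\<close>
  then have product: "cauchy_coeff (lkp p) \<phi> = lkp ?pt"
    using expands_unique_coeff[OF _ expands_poly_at] by blast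

  have euler_sum: "(\<lambda>k. dirichlet_weight \<alpha> k * (norm (euler_coeff j \<phi> k))\<^sup>2) summable_on UNIV" for j
  proof -
    obtain e M where e: "expands (euler_coeff j (lkp p)) e" "\<And>z. z \<in> polydisc \<Longrightarrow> norm (e z) \<le> M"
      using euler_coeff_poly_bounded[of j p] by blast
    obtain e' M' where e': "expands (euler_coeff j (lkp ?pt)) e'"
        "\<And>z. z \<in> polydisc \<Longrightarrow> norm (e' z) \<le> M'"
      using euler_coeff_poly_bounded[of j ?pt] by blast
    obtain F where F: "expands (euler_coeff j \<phi>) F"
      using expands_euler_coeff[OF \<phi>] by blast
    \<comment> \<open>\<open>H\<close> is the coefficient family of the bounded factor
      \<open>\<theta>_j q - \<phi> \<theta>_j p\<close>, where \<open>q\<close> is the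
      reflection.\<close>
    define H where "H = (\<lambda>k. euler_coeff j (lkp ?pt) k - cauchy_coeff (euler_coeff j (lkp p)) \<phi> k)"
    define h where "h = (\<lambda>z. e' z - e z * rational_inner p z)"
    have H: "expands H h"
      unfolding H_def h_def by (intro expands_diff expands_mult e e' \<phi>)
    have h_le: "norm (h z) \<le> M' + M" if "z \<in> polydisc" for z
    proof -
      have "norm (e z * rational_inner p z) \<le> M * 1"
        unfolding norm_mult using e(2)[OF that] inner_le[OF that] 
        by (intro mult_mono order_trans[OF norm_ge_zero, of "e z" M]) auto
      then show ?thesis
        unfolding h_def using e'(2)[OF that] norm_triangle_ineq4[of "e' z" "e z * rational_inner p z"]
        by simp
    qed
    \<comment> \<open>The Leibniz rule applied to \<open>product\<close> isolates \<open>p\<close>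
      times the Euler derivative of the inner function.\<close>
    have "cauchy_coeff (lkp p) (euler_coeff j \<phi>) k = H k" for k
      using euler_coeff_cauchy_coeff[of j "lkp p" \<phi> k] by (simp add: H_def product)
    then have "cauchy_coeff (lkp p) (euler_coeff j \<phi>) = H"
      by blast
    then have "expands H (\<lambda>z. poly_at p z * F z)"
      using expands_mult[OF expands_poly_at F, of p] by simp
    \<comment> \<open>The division by \<open>p\<close> is carried out on values, and uniqueness of
      coefficients then turns \<open>F = (1/p) h\<close> into a Cauchy product of \<open>g\<close>
      with a bounded function.\<close>
    then have "h z = poly_at p z * F z" if "z \<in> polydisc" for z
      using expands_unique_value[OF H] that by blast
    then have "1 / poly_at p z * h z = F z" if "z \<in> polydisc" for z
      using that nz by simp
    then have "expands (cauchy_coeff g H) F"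
      using expands_cong[OF expands_mult[OF g H]] by blast
    then have "euler_coeff j \<phi> = cauchy_coeff g H"
      using expands_unique_coeff[OF F] by blast
    then show ?thesis
      using summable_weighted_cauchy_coeff[OF H h_le \<open>\<alpha> < 0\<close> g_sum] by simp
  qed
  obtain M where M: "\<And>z. z \<in> polydisc \<Longrightarrow> norm (poly_at ?pt z) \<le> M"
    using expands_finite_support_bounded[of "Poly_Mapping.keys ?pt" "lkp ?pt"] expands_poly_at[of ?pt]
      expands_unique_value by (metis in_keys_iff finite_keys)
  have \<phi>_sum: "(\<lambda>k. dirichlet_weight \<alpha> k * (norm (\<phi> k))\<^sup>2) summable_on UNIV"
    unfolding \<phi>_def by (rule summable_weighted_cauchy_coeff[OF expands_poly_at M \<open>\<alpha> < 0\<close> g_sum])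

  have "(\<lambda>k. dirichlet_weight (\<alpha> + 2 / real CARD('n)) k * (norm (\<phi> k))\<^sup>2) summable_on UNIV"
  proof (rule summable_on_comparison_test)
    \<comment> \<open>The majorant comes from \<open>(1 + m)^2 \<le> 2 + 2 * m^2\<close> with
      \<open>m = lkp k j\<close>: the constant part is controlled by \<open>\<phi_sum>\<close> below
      in the form \<open>\<phi>\<close>, the quadratic part by the Euler derivative, whose
      coefficients carry the factor \<open>m\<close>.\<close>
    let ?b = "\<lambda>k. \<Sum>j\<in>UNIV. 2 * (dirichlet_weight \<alpha> k * (norm (\<phi> k))\<^sup>2)
      + 2 * (dirichlet_weight \<alpha> k * (norm (euler_coeff j \<phi> k))\<^sup>2)"
    have "(?b has_sum (\<Sum>j\<in>UNIV. 2 * infsum (\<lambda>k. dirichlet_weight \<alpha> k * (norm (\<phi> k))\<^sup>2) UNIV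
        + 2 * infsum (\<lambda>k. dirichlet_weight \<alpha> k * (norm (euler_coeff j \<phi> k))\<^sup>2) UNIV)) UNIV"
      by (intro has_sum_finite_sum has_sum_add has_sum_cmult_right has_sum_infsum \<phi>_sum euler_sum)
    then show "?b summable_on UNIV"
      by (rule has_sum_imp_summable)
    fix k :: "'n \<Rightarrow>\<^sub>0 nat"
    have sq: "(1 + x)\<^sup>2 \<le> 2 + 2 * x\<^sup>2" for x :: real
      using sum_squares_bound[of 1 x] by (simp add: power2_sum)
    have "dirichlet_weight (2 / real CARD('n)) k \<le> (\<Sum>j\<in>UNIV. (1 + real (lkp k j))\<^sup>2)"
      using prod_powr_le_sum_squares[of "\<lambda>j. 1 + real (lkp k j)"] by (simp add: dirichlet_weight_def)
    also have "\<dots> \<le> (\<Sum>j\<in>UNIV. 2 + 2 * (real (lkp k j))\<^sup>2)"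
      by (intro sum_mono sq)
    finally have "dirichlet_weight \<alpha> k * dirichlet_weight (2 / real CARD('n)) k * (norm (\<phi> k))\<^sup>2
        \<le> dirichlet_weight \<alpha> k * (\<Sum>j\<in>UNIV. 2 + 2 * (real (lkp k j))\<^sup>2) * (norm (\<phi> k))\<^sup>2"
      by (intro mult_right_mono mult_left_mono) auto
    also have "\<dots> = ?b k"
      unfolding sum_distrib_left sum_distrib_right
      by (intro sum.cong) (auto simp: euler_coeff_def norm_mult power_mult_distrib algebra_simps)
    finally show "dirichlet_weight (\<alpha> + 2 / real CARD('n)) k * (norm (\<phi> k))\<^sup>2 \<le> ?b k"
      by (simp only: dirichlet_weight_add)
  qed simp
  \<comment> \<open>Holomorphy of \<open>1/p\<close> is part of its membership in the Dirichlet
    space, so multiplying by the polynomial \<open>reflection p\<close> is enough.\<close>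
  moreover have "holomorphic_several_on (rational_inner p) polydisc"
    using holomorphic_several_on_mult[OF holomorphic_several_on_poly_at hol, of ?pt]
    by (simp add: rational_inner_def[abs_def])
  ultimately show ?thesis
    using \<phi> unfolding dirichlet_space_def expands_def dirichlet_weight_def by blast
qed

end
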